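(* Let $F$ be a planar graph with a fixed planar embedding and $f$ an edge of $F$ lying on the outer face of $F$; let $G$ be a planar graph with a fixed planar embedding and $g$ an edge of $G$ lying on the outer face of $G$. Let $T$ be the cycle graph on $n$ vertices, embedded in the plane, with edges $t_0,t_1,\dots,t_{n-1}$ labelled in the order they appear along the cycle. For each integer $i$ with $1\le i\le n-1$, let $J_i$ be the planar graph obtained by (1) merging the edge $t_0$ of $T$ with the edge $g$ of $G$ (identifying their endpoints and the two edges into one edge) so that all vertices of $G$ lie in the outer face of $T$, and (2) merging the edge $t_i$ of $T$ with the edge $f$ of $F$ in the same way so that all vertices of $F$ lie in the outer face of $T$, in such a way that the embeddings of $F$ and $G$ are preserved and exactly $n-2$ edges of the cycle $T$ lie on the outer face of $J_i$. Then the sandpile group $S(J_i)$ does not depend on $i$: $S(J_i)\cong S(J_j)$ for all $1\le i,j\le n-1$.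
   Context: For a finite multigraph $X$ with Laplacian matrix $L$ (diagonal entries the vertex degrees, off-diagonal entry $(u,v)$ equal to minus the number of edges between $u$ and $v$), the sandpile group is $S(X)\cong\bigoplus_{a} C_{|a|}$, where $a$ ranges over the nonzero diagonal entries (with multiplicity) of the Smith normal form of $L$, and $C_m$ denotes the cyclic group of order $m$. *)

theory Defs
  imports
    "HOL-Analysis.Homotopy"
    "HOL-Algebra.Elementary_Groups"
    "HOL-Algebra.Product_Groups"
    "Jordan_Normal_Form.Matrix"
begin

section \<open>Multigraphs and their sandpile groups\<close>

record ('v, 'e) multigraph =
  verts :: "'v set"
  edges :: "'e set"
  ends :: "'e \<Rightarrow> 'v set"

text \<open>Parallel edges are allowed, loops are not.\<close>

definition finite_multigraph :: "('v, 'e) multigraph \<Rightarrow> bool" where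
  "finite_multigraph X \<longleftrightarrow>
     finite (verts X) \<and> finite (edges X) \<and>
     (\<forall>e\<in>edges X. ends X e \<subseteq> verts X \<and> card (ends X e) = 2)"

definition degree :: "('v, 'e) multigraph \<Rightarrow> 'v \<Rightarrow> nat" where
  "degree X v = card {e \<in> edges X. v \<in> ends X e}"

definition edge_count :: "('v, 'e) multigraph \<Rightarrow> 'v \<Rightarrow> 'v \<Rightarrow> nat" where
  "edge_count X u v = card {e \<in> edges X. ends X e = {u, v}}"

text \<open>The list \<open>vs\<close> enumerates the vertices and fixes the order of rows and columns.\<close>

definition laplacian :: "('v, 'e) multigraph \<Rightarrow> 'v list \<Rightarrow> int mat" where
  "laplacian X vs = Matrix.mat (length vs) (length vs)
     (\<lambda>(i, j). if i = j then int (degree X (vs ! i))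
               else - int (edge_count X (vs ! i) (vs ! j)))"

text \<open>The diagonal entries are determined only up to sign; the sandpile group uses
  their absolute values.\<close>

definition smith_normal_form_of :: "int mat \<Rightarrow> int mat \<Rightarrow> bool" where
  "smith_normal_form_of D A \<longleftrightarrow>
     (\<exists>P Q. P \<in> carrier_mat (dim_row A) (dim_row A) \<and> invertible_mat P \<and>
            Q \<in> carrier_mat (dim_col A) (dim_col A) \<and> invertible_mat Q \<and>
            D = P * A * Q) \<and>
     diagonal_mat D \<and>
     (\<forall>k. Suc k < min (dim_row D) (dim_col D) \<longrightarrow>
          D $$ (k, k) dvd D $$ (Suc k, Suc k))"

text \<open>The choice of \<open>vs\<close> is immaterial (reordering the vertices multiplies the Laplacian by
  permutation matrices), and \<open>D\<close> is unique up to signs.\<close>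

definition laplacian_snf :: "('v, 'e) multigraph \<Rightarrow> int mat" where
  "laplacian_snf X =
     (SOME D. \<exists>vs. distinct vs \<and> set vs = verts X \<and>
                   smith_normal_form_of D (laplacian X vs))"

definition sandpile_group :: "('v, 'e) multigraph \<Rightarrow> (nat \<Rightarrow> int) monoid" where
  "sandpile_group X =
     (let D = laplacian_snf X
      in sum_group {k. k < dim_row D \<and> D $$ (k, k) \<noteq> 0}
           (\<lambda>k. integer_mod_group (nat \<bar>D $$ (k, k)\<bar>)))"

section \<open>Multigraphs embedded in the plane\<close>

text \<open>A graph with a fixed embedding is given by the points that are its vertices and the
  arcs (as point sets) that are its edges. Parallel edges are distinct arcs with
  the same endpoints.\<close>

record plane_graph =
  pverts :: "complex set"
  pedges :: "complex set set"

definition plane_multigraph :: "plane_graph \<Rightarrow> bool" where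
  "plane_multigraph X \<longleftrightarrow>
     finite (pverts X) \<and> finite (pedges X) \<and>
     (\<forall>e\<in>pedges X. \<exists>\<gamma>. arc \<gamma> \<and> path_image \<gamma> = e \<and>
         e \<inter> pverts X = {pathstart \<gamma>, pathfinish \<gamma>}) \<and>
     (\<forall>e\<in>pedges X. \<forall>e'\<in>pedges X. e \<noteq> e' \<longrightarrow> e \<inter> e' \<subseteq> pverts X)"

definition underlying_graph :: "plane_graph \<Rightarrow> (complex, complex set) multigraph" where
  "underlying_graph X =
     \<lparr>verts = pverts X, edges = pedges X, ends = (\<lambda>e. e \<inter> pverts X)\<rparr>"

lemma finite_multigraph_underlying_graph:
  assumes "plane_multigraph X"
  shows "finite_multigraph (underlying_graph X)"
proof -
  have "card (e \<inter> pverts X) = 2" if e: "e \<in> pedges X" for e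
  proof -
    obtain \<gamma> where \<gamma>: "arc \<gamma>" and eq: "e \<inter> pverts X = {pathstart \<gamma>, pathfinish \<gamma>}"
      using assms e unfolding plane_multigraph_def by meson
    have "pathstart \<gamma> \<noteq> pathfinish \<gamma>"
      using arc_distinct_ends[OF \<gamma>] by metis
    then show ?thesis
      unfolding eq by (rule card_2_iff[THEN iffD2, OF exI, OF exI, OF conjI[OF refl]])
  qed
  moreover have "finite (pverts X)" "finite (pedges X)"
    using assms unfolding plane_multigraph_def by iprover+
  ultimately show ?thesis
    by (simp add: finite_multigraph_def underlying_graph_def)
qed

definition drawing :: "plane_graph \<Rightarrow> complex set" where
  "drawing X = pverts X \<union> \<Union>(pedges X)"

definition outer_face :: "plane_graph \<Rightarrow> complex set" where
  "outer_face X = outside (drawing X)"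

definition on_outer_face :: "plane_graph \<Rightarrow> complex set \<Rightarrow> bool" where
  "on_outer_face X e \<longleftrightarrow> e \<in> pedges X \<and> e \<subseteq> frontier (outer_face X)"

definition plane_cycle :: "nat \<Rightarrow> (nat \<Rightarrow> complex set) \<Rightarrow> plane_graph \<Rightarrow> bool" where
  "plane_cycle n t T \<longleftrightarrow>
     plane_multigraph T \<and>
     (\<exists>v. inj_on v {..<n} \<and> pverts T = v ` {..<n} \<and>
          inj_on t {..<n} \<and> pedges T = t ` {..<n} \<and>
          (\<forall>k<n. t k \<inter> pverts T = {v k, v (Suc k mod n)}))"

section \<open>Merging along edges\<close>

text \<open>A homeomorphism of the plane preserves the orientation iff it is isotopic to the
  identity. Moving a plane graph by such a map preserves its embedding: the cyclic order of
  the edges at every vertex, the faces, and which of them is the outer one.\<close>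

definition plane_isotopic_to_id :: "(complex \<Rightarrow> complex) \<Rightarrow> bool" where
  "plane_isotopic_to_id \<phi> \<longleftrightarrow>
     homotopic_with_canon (\<lambda>\<psi>. \<exists>\<psi>'. homeomorphism UNIV UNIV \<psi> \<psi>') UNIV UNIV id \<phi>"

definition move :: "(complex \<Rightarrow> complex) \<Rightarrow> plane_graph \<Rightarrow> plane_graph" where
  "move \<phi> X = \<lparr>pverts = \<phi> ` pverts X, pedges = (\<lambda>e. \<phi> ` e) ` pedges X\<rparr>"

definition plane_union :: "plane_graph \<Rightarrow> plane_graph \<Rightarrow> plane_graph" where
  "plane_union X Y = \<lparr>pverts = pverts X \<union> pverts Y, pedges = pedges X \<union> pedges Y\<rparr>"

text \<open>\<open>H\<close> is a copy of \<open>X\<close>, with the same embedding, placed in the plane in such a way that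
  its edge \<open>x\<close> becomes the edge \<open>s\<close> of \<open>T\<close>, nothing else of \<open>H\<close> touches \<open>T\<close>, and all vertices of
  \<open>H\<close> (other than the two endpoints of \<open>s\<close>, which lie on \<open>T\<close>) are in the outer face of \<open>T\<close>.\<close>

definition merged_copy ::
    "plane_graph \<Rightarrow> complex set \<Rightarrow> plane_graph \<Rightarrow> complex set \<Rightarrow> plane_graph \<Rightarrow> bool" where
  "merged_copy X x T s H \<longleftrightarrow>
     (\<exists>\<phi>. plane_isotopic_to_id \<phi> \<and> H = move \<phi> X \<and> \<phi> ` x = s) \<and>
     drawing H \<inter> drawing T = s \<and>
     pverts H - s \<subseteq> outer_face T"

text \<open>\<open>J\<close> arises from the cycle \<open>T\<close> with edges \<open>t 0, \<dots>, t (n - 1)\<close> by merging \<open>t 0\<close> with the edge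
  \<open>g\<close> of \<open>G\<close> and \<open>t i\<close> with the edge \<open>f\<close> of \<open>F\<close>. The copies of \<open>G\<close> and \<open>F\<close> have
  nothing in common except the vertices shared by \<open>t 0\<close> and \<open>t i\<close>, if any.\<close>

definition cycle_merging ::
    "plane_graph \<Rightarrow> complex set \<Rightarrow> plane_graph \<Rightarrow> complex set \<Rightarrow>
     nat \<Rightarrow> (nat \<Rightarrow> complex set) \<Rightarrow> plane_graph \<Rightarrow> nat \<Rightarrow> plane_graph \<Rightarrow> bool" where
  "cycle_merging F f G g n t T i J \<longleftrightarrow>
     (\<exists>G' F'. merged_copy G g T (t 0) G' \<and> merged_copy F f T (t i) F' \<and>
              drawing G' \<inter> drawing F' = t 0 \<inter> t i \<and>
              J = plane_union T (plane_union G' F')) \<and>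
     plane_multigraph J \<and>
     card {k. k < n \<and> on_outer_face J (t k)} = n - 2"

end

theory Submission
  imports Defs "HOL-Analysis.Uncountable_Sets"
begin

text \<open>The Laplacian is the Gram matrix of the Dirichlet form
  \<open>(x, y) \<mapsto> \<Sum>\<^bsub>uv\<^esub> (x u - x v) (y u - y v)\<close> on integer vertex potentials. The graphs \<open>J\<^sub>i\<close> and \<open>J\<^sub>j\<close>
  differ by Whitney twists, which reorder and reverse the pieces strung along the cycle: reflecting the
  potential on the piece of the cycle between the positions \<open>i\<close> and \<open>j\<close>, and carrying it
  over to the copies of \<open>F\<close> and \<open>G\<close> up to sign and additive constant, changes potential differences
  along edges only by signs and a permutation of the edges. This is an integral isometry between the
  Dirichlet forms, so the two Laplacians are congruent over the integers and have the same
  Smith normal forms.\<close>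

section \<open>Dirichlet forms and Laplacians\<close>

text \<open>For an edge \<open>A = {u, v}\<close> this is twice the product of the differences; summing over ordered
  pairs avoids choosing an orientation.\<close>

definition edge_form :: "('v \<Rightarrow> int) \<Rightarrow> ('v \<Rightarrow> int) \<Rightarrow> 'v set \<Rightarrow> int" where
  "edge_form x y A = (\<Sum>u\<in>A. \<Sum>v\<in>A. (x u - x v) * (y u - y v))"

definition dirichlet_form ::
    "('v, 'e) multigraph \<Rightarrow> ('v \<Rightarrow> int) \<Rightarrow> ('v \<Rightarrow> int) \<Rightarrow> int" where
  "dirichlet_form X x y = (\<Sum>e\<in>edges X. edge_form x y (ends X e))"

abbreviation unit_at :: "'v \<Rightarrow> 'v \<Rightarrow> int" where
  "unit_at u \<equiv> (\<lambda>w. of_bool (w = u))"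

lemma edge_form_pair:
  assumes "u \<noteq> v"
  shows "edge_form x y {u, v} = 2 * ((x u - x v) * (y u - y v))"
  using assms by (simp add: edge_form_def algebra_simps)

lemma edge_form_cong:
  assumes "\<And>w. w \<in> A \<Longrightarrow> x w = x' w" "\<And>w. w \<in> A \<Longrightarrow> y w = y' w"
  shows "edge_form x y A = edge_form x' y' A"
  unfolding edge_form_def using assms by (intro sum.cong) auto

lemma edge_form_image:
  assumes "inj_on h A"
  shows "edge_form x y (h ` A) = edge_form (x \<circ> h) (y \<circ> h) A"
  using assms by (simp add: edge_form_def sum.reindex)

text \<open>The constants cancel in every difference, and the two factors \<open>s\<close> multiply
  to 1. Over the integers \<open>s\<close> is a sign, so reversing and shifting a potential on an
  attached graph costs nothing.\<close>

lemma edge_form_affine: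
  assumes "s * s = 1"
  shows "edge_form (\<lambda>w. c + s * x w) (\<lambda>w. c' + s * y w) A = edge_form x y A"
proof -
  have "(c + s * p - (c + s * q)) * (c' + s * p' - (c' + s * q')) = (p - q) * (p' - q')"
    for p q p' q' :: int
  proof -
    have "(c + s * p - (c + s * q)) * (c' + s * p' - (c' + s * q')) = s * s * ((p - q) * (p' - q'))"
      by (simp add: algebra_simps)
    then show ?thesis using assms by simp
  qed
  then show ?thesis by (simp add: edge_form_def)
qed

lemma edge_form_sum_left:
  "edge_form (\<lambda>w. \<Sum>a\<in>V. c a * z a w) y A = (\<Sum>a\<in>V. c a * edge_form (z a) y A)"
proof -
  have "edge_form (\<lambda>w. \<Sum>a\<in>V. c a * z a w) y A =
      (\<Sum>u\<in>A. \<Sum>v\<in>A. \<Sum>a\<in>V. c a * ((z a u - z a v) * (y u - y v)))"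
    by (simp add: edge_form_def sum_distrib_right left_diff_distrib right_diff_distrib mult.assoc
        flip: sum_subtractf)
  also have "\<dots> = (\<Sum>u\<in>A. \<Sum>a\<in>V. \<Sum>v\<in>A. c a * ((z a u - z a v) * (y u - y v)))"
    by (intro sum.cong refl sum.swap)
  also have "\<dots> = (\<Sum>a\<in>V. \<Sum>u\<in>A. \<Sum>v\<in>A. c a * ((z a u - z a v) * (y u - y v)))"
    by (rule sum.swap)
  finally show ?thesis
    by (simp add: edge_form_def sum_distrib_left)
qed

lemma edge_form_commute: "edge_form x y A = edge_form y x A"
  by (simp add: edge_form_def mult.commute)

lemma dirichlet_form_commute: "dirichlet_form X x y = dirichlet_form X y x"
  by (simp add: dirichlet_form_def edge_form_commute)

lemma dirichlet_form_cong:
  assumes "finite_multigraph X"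
    and "\<And>w. w \<in> verts X \<Longrightarrow> x w = x' w" "\<And>w. w \<in> verts X \<Longrightarrow> y w = y' w"
  shows "dirichlet_form X x y = dirichlet_form X x' y'"
  unfolding dirichlet_form_def
  by (intro sum.cong refl edge_form_cong) (use assms in \<open>auto simp: finite_multigraph_def\<close>)

lemma dirichlet_form_affine:
  assumes "s * s = 1"
  shows "dirichlet_form X (\<lambda>w. c + s * x w) (\<lambda>w. c' + s * y w) = dirichlet_form X x y"
  by (simp add: dirichlet_form_def edge_form_affine[OF assms])

lemma dirichlet_form_sum_left:
  "dirichlet_form X (\<lambda>w. \<Sum>a\<in>V. c a * z a w) y = (\<Sum>a\<in>V. c a * dirichlet_form X (z a) y)"
  unfolding dirichlet_form_def edge_form_sum_left sum_distrib_left by (rule sum.swap)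

lemma sum_unit_at:
  assumes "finite V" "w \<in> V"
  shows "(\<Sum>a\<in>V. x a * unit_at a w) = x w"
  using assms by (simp add: if_distrib of_bool_def cong: if_cong)

text \<open>Bilinear expansion over the unit potentials. It may be restricted to the vertices
  because edges have their ends there.\<close>

lemma dirichlet_form_expand:
  assumes "finite_multigraph X"
  shows "dirichlet_form X x y =
    (\<Sum>a\<in>verts X. \<Sum>b\<in>verts X. x a * y b * dirichlet_form X (unit_at a) (unit_at b))"
proof -
  have fin: "finite (verts X)" using assms by (simp add: finite_multigraph_def)
  have 1: "dirichlet_form X x y = (\<Sum>a\<in>verts X. x a * dirichlet_form X (unit_at a) y)" for x y
    by (subst dirichlet_form_sum_left[symmetric])
      (rule dirichlet_form_cong[OF assms], simp_all add: sum_unit_at[OF fin])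
  have 2: "dirichlet_form X (unit_at a) y =
      (\<Sum>b\<in>verts X. y b * dirichlet_form X (unit_at a) (unit_at b))" for a
    by (subst dirichlet_form_commute, subst 1, subst dirichlet_form_commute) (rule refl)
  show ?thesis
    by (subst 1, subst 2) (simp add: sum_distrib_left mult.assoc)
qed

text \<open>The factor 2 stems from the ordered pairs in \<open>edge_form\<close>. On the diagonal
  every edge at the vertex contributes 2; off the diagonal only edges joining the two vertices
  contribute, each with -2.\<close>

lemma laplacian_eq_dirichlet_form:
  assumes X: "finite_multigraph X" and p: "p < length vs" and q: "q < length vs"
    and vs: "distinct vs"
  shows "2 * laplacian X vs $$ (p, q) = dirichlet_form X (unit_at (vs ! p)) (unit_at (vs ! q))"
proof -
  let ?a = "vs ! p" and ?b = "vs ! q"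
  have fin: "finite (edges X)" using X by (simp add: finite_multigraph_def)
  have pair: "\<exists>u v. u \<noteq> v \<and> ends X e = {u, v}" if "e \<in> edges X" for e
    using X that unfolding finite_multigraph_def card_2_iff by blast
  show ?thesis
  proof (cases "p = q")
    case True
    have "dirichlet_form X (unit_at ?a) (unit_at ?a) = (\<Sum>e\<in>edges X. if ?a \<in> ends X e then 2 else 0)"
      unfolding dirichlet_form_def
    proof (rule sum.cong[OF refl])
      fix e assume "e \<in> edges X"
      then obtain u v where "u \<noteq> v" "ends X e = {u, v}" using pair by blast
      then show "edge_form (unit_at ?a) (unit_at ?a) (ends X e) = (if ?a \<in> ends X e then 2 else 0)"
        by (auto simp: edge_form_pair)
    qed
    also have "\<dots> = 2 * int (degree X ?a)"
      using fin by (simp add: degree_def sum.If_cases Int_def)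
    finally show ?thesis using True p by (simp add: laplacian_def)
  next
    case False
    then have ab: "?a \<noteq> ?b" using vs p q by (simp add: nth_eq_iff_index_eq)
    have "dirichlet_form X (unit_at ?a) (unit_at ?b) =
        (\<Sum>e\<in>edges X. if ends X e = {?a, ?b} then - 2 else 0)"
      unfolding dirichlet_form_def
    proof (rule sum.cong[OF refl])
      fix e assume "e \<in> edges X"
      then obtain u v where "u \<noteq> v" "ends X e = {u, v}" using pair by blast
      then show "edge_form (unit_at ?a) (unit_at ?b) (ends X e) =
          (if ends X e = {?a, ?b} then - 2 else 0)"
        using ab by (auto simp: edge_form_pair doubleton_eq_iff)
    qed
    also have "\<dots> = - 2 * int (edge_count X ?a ?b)"
      using fin by (simp add: edge_count_def sum.If_cases Int_def)
    finally show ?thesis using False p q by (simp add: laplacian_def)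
  qed
qed

section \<open>Integer-linear maps of potentials and their matrices\<close>

text \<open>Potentials are total functions, so the second conjunct makes \<open>M\<close> depend only on the values
  on \<open>V\<close>.\<close>

definition potential_map ::
    "'v set \<Rightarrow> 'w set \<Rightarrow> (('v \<Rightarrow> int) \<Rightarrow> 'w \<Rightarrow> int) \<Rightarrow> bool" where
  "potential_map V W M \<longleftrightarrow>
     (\<forall>x y. \<forall>w\<in>W. M (\<lambda>v. x v + y v) w = M x w + M y w) \<and>
     (\<forall>x y. (\<forall>v\<in>V. x v = y v) \<longrightarrow> (\<forall>w\<in>W. M x w = M y w))"

text \<open>Additivity already gives linearity over the integers, and on \<open>V\<close> every
  potential is an integer combination of unit potentials.\<close>

lemma potential_map_expand:
  assumes M: "potential_map V W M" and fin: "finite V" and w: "w \<in> W"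
  shows "M x w = (\<Sum>a\<in>V. x a * M (unit_at a) w)"
proof -
  have add: "M (\<lambda>v. x v + y v) w = M x w + M y w" for x y
    using M w by (simp add: potential_map_def)
  have zero: "M (\<lambda>v. 0) w = 0"
    using add[of "\<lambda>v. 0" "\<lambda>v. 0"] by simp
  have nat_scale: "M (\<lambda>v. int n * y v) w = int n * M y w" for n y
    by (induction n) (simp_all add: zero add distrib_right)
  have scale: "M (\<lambda>v. c * y v) w = c * M y w" for c y
  proof (cases "0 \<le> c")
    case True
    then show ?thesis using nat_scale[of "nat c"] by simp
  next
    case False
    \<comment> \<open>A negative multiple is found by cancelling it against the opposite nonnegative
      one.\<close>
    have "M (\<lambda>v. c * y v + int (nat (- c)) * y v) w = 0"
      using False zero by simp
    then have "M (\<lambda>v. c * y v) w + int (nat (- c)) * M y w = 0"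
      unfolding add nat_scale .
    then show ?thesis using False by simp
  qed
  have sum: "finite S \<Longrightarrow> M (\<lambda>v. \<Sum>a\<in>S. x a * unit_at a v) w = (\<Sum>a\<in>S. x a * M (unit_at a) w)" for S
    by (induction S rule: finite_induct)
      (simp_all only: sum.empty sum.insert zero add scale not_False_eq_True)
  have "M x w = M (\<lambda>v. \<Sum>a\<in>V. x a * unit_at a v) w"
  proof -
    have agree: "\<forall>v\<in>V. x v = (\<Sum>a\<in>V. x a * unit_at a v)"
      by (intro ballI sum_unit_at[OF fin, symmetric])
    have only_V: "M x w = M y w" if "\<forall>v\<in>V. x v = y v" for y
      using M w that by (simp add: potential_map_def)
    show ?thesis by (rule only_V[OF agree])
  qed
  then show ?thesis using sum[OF fin] by simp
qed

definition potential_matrix ::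
    "(('v \<Rightarrow> int) \<Rightarrow> 'w \<Rightarrow> int) \<Rightarrow> 'v list \<Rightarrow> 'w list \<Rightarrow> int mat" where
  "potential_matrix M vs ws =
     Matrix.mat (length ws) (length vs) (\<lambda>(p, q). M (unit_at (vs ! q)) (ws ! p))"

lemma sum_list_index:
  assumes "distinct vs"
  shows "(\<Sum>k = 0..<length vs. h (vs ! k)) = (\<Sum>v\<in>set vs. h v)"
proof -
  have "bij_betw ((!) vs) {0..<length vs} (set vs)"
    using bij_betw_nth[OF assms] by (simp add: atLeast0LessThan)
  then show ?thesis by (rule sum.reindex_bij_betw)
qed

text \<open>Columns hold the images of unit potentials, so an entry of the product is the expansion
  of \<open>M'\<close> applied to \<open>M (unit_at (vs ! q))\<close>, which is the unit potential
  again.\<close>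

lemma potential_matrix_inverse:
  assumes M': "potential_map W V M'"
    and vs: "distinct vs" "set vs = V" and ws: "distinct ws" "set ws = W"
    and inv: "\<And>x v. v \<in> V \<Longrightarrow> M' (M x) v = x v"
  shows "potential_matrix M' ws vs * potential_matrix M vs ws = 1\<^sub>m (length vs)"
proof (rule eq_matI)
  fix p q assume "p < dim_row (1\<^sub>m (length vs) :: int mat)" "q < dim_col (1\<^sub>m (length vs) :: int mat)"
  then have p: "p < length vs" and q: "q < length vs" by auto
  have "(potential_matrix M' ws vs * potential_matrix M vs ws) $$ (p, q) =
      (\<Sum>k = 0..<length ws. M' (unit_at (ws ! k)) (vs ! p) * M (unit_at (vs ! q)) (ws ! k))"
    using p q by (simp add: potential_matrix_def scalar_prod_def)
  also have "\<dots> = (\<Sum>w\<in>W. M' (unit_at w) (vs ! p) * M (unit_at (vs ! q)) w)"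
    using sum_list_index[OF ws(1), of "\<lambda>w. M' (unit_at w) (vs ! p) * M (unit_at (vs ! q)) w"] ws(2)
    by simp
  also have "\<dots> = M' (M (unit_at (vs ! q))) (vs ! p)"
    using p vs(2) ws(2) by (subst potential_map_expand[OF M', of _ "M (unit_at (vs ! q))"])
      (auto simp: mult.commute)
  also have "\<dots> = unit_at (vs ! q) (vs ! p)"
    using p vs(2) by (intro inv) auto
  finally show "(potential_matrix M' ws vs * potential_matrix M vs ws) $$ (p, q) = 1\<^sub>m (length vs) $$ (p, q)"
    using p q vs(1) by (simp add: nth_eq_iff_index_eq)
qed (simp_all add: potential_matrix_def)

text \<open>An entry on the right is half the form of \<open>Y\<close> at the images of two unit
  potentials, expanded over the vertices of \<open>Y\<close>; the isometry turns it into half the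
  form of \<open>X\<close> at these unit potentials.\<close>

lemma laplacian_congruence:
  assumes X: "finite_multigraph X" and Y: "finite_multigraph Y"
    and vs: "distinct vs" "set vs = verts X" and ws: "distinct ws" "set ws = verts Y"
    and form: "\<And>x y. dirichlet_form Y (M x) (M y) = dirichlet_form X x y"
  shows "laplacian X vs =
    transpose_mat (potential_matrix M vs ws) * laplacian Y ws * potential_matrix M vs ws"
    (is "_ = transpose_mat ?P * ?L * ?P")
proof (rule eq_matI)
  fix p q assume "p < dim_row (transpose_mat ?P * ?L * ?P)" "q < dim_col (transpose_mat ?P * ?L * ?P)"
  then have p: "p < length vs" and q: "q < length vs" by (auto simp: potential_matrix_def)
  let ?x = "M (unit_at (vs ! p))" and ?y = "M (unit_at (vs ! q))"
  have "(transpose_mat ?P * ?L * ?P) $$ (p, q) =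
      (\<Sum>l = 0..<length ws. (\<Sum>k = 0..<length ws. ?x (ws ! k) * ?L $$ (k, l)) * ?y (ws ! l))"
    using p q by (simp add: potential_matrix_def laplacian_def scalar_prod_def)
  \<comment> \<open>Doubling both sides replaces Laplacian entries by values of the form without any
    division.\<close>
  then have "2 * (transpose_mat ?P * ?L * ?P) $$ (p, q) =
      (\<Sum>l = 0..<length ws. \<Sum>k = 0..<length ws. ?x (ws ! k) * ?y (ws ! l) * (2 * ?L $$ (k, l)))"
    by (simp add: sum_distrib_left sum_distrib_right mult_ac)
  also have "\<dots> = (\<Sum>l = 0..<length ws. \<Sum>k = 0..<length ws. ?x (ws ! k) * ?y (ws ! l) *
      dirichlet_form Y (unit_at (ws ! k)) (unit_at (ws ! l)))"
    using Y ws(1) by (intro sum.cong refl) (simp add: laplacian_eq_dirichlet_form)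
  also have "\<dots> = (\<Sum>b\<in>verts Y. \<Sum>a\<in>verts Y. ?x a * ?y b * dirichlet_form Y (unit_at a) (unit_at b))"
    unfolding ws(2)[symmetric]
    by (subst sum_list_index[OF ws(1), symmetric], subst sum_list_index[OF ws(1), symmetric]) (rule refl)
  also have "\<dots> = dirichlet_form Y ?x ?y"
    by (subst sum.swap) (rule dirichlet_form_expand[OF Y, symmetric])
  also have "\<dots> = 2 * laplacian X vs $$ (p, q)"
    unfolding form by (rule laplacian_eq_dirichlet_form[OF X p q vs(1), symmetric])
  finally show "laplacian X vs $$ (p, q) = (transpose_mat ?P * ?L * ?P) $$ (p, q)" by simp
qed (simp_all add: potential_matrix_def laplacian_def)

section \<open>Invertible matrices and Smith normal forms under congruence\<close>

lemma invertible_mat_of_inverse: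
  fixes A :: "'a :: comm_ring_1 mat"
  assumes "A \<in> carrier_mat n n" "B \<in> carrier_mat n n" "A * B = 1\<^sub>m n" "B * A = 1\<^sub>m n"
  shows "invertible_mat A"
  unfolding invertible_mat_def inverts_mat_def using assms by auto

lemma invertible_mat_obtain:
  fixes A :: "'a :: comm_ring_1 mat"
  assumes "invertible_mat A" and A: "A \<in> carrier_mat n n"
  obtains B where "B \<in> carrier_mat n n" "A * B = 1\<^sub>m n" "B * A = 1\<^sub>m n"
proof -
  obtain B where AB: "A * B = 1\<^sub>m (dim_row A)" and BA: "B * A = 1\<^sub>m (dim_row B)"
    using assms(1) unfolding invertible_mat_def inverts_mat_def by auto
  \<comment> \<open>\<open>inverts_mat\<close> does not prescribe the shape of \<open>B\<close>; it
    is read off from the sizes of the two products.\<close>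
  have "dim_col B = n" using AB A by (metis carrier_matD(1) index_mult_mat(3) index_one_mat(3))
  moreover have "dim_row B = n" using BA A by (metis carrier_matD(2) index_mult_mat(3) index_one_mat(3))
  ultimately show ?thesis using AB BA A that by (metis carrier_matI carrier_matD(1))
qed

lemma invertible_mat_mult:
  fixes A B :: "'a :: comm_ring_1 mat"
  assumes "invertible_mat A" "invertible_mat B" and A: "A \<in> carrier_mat n n" and B: "B \<in> carrier_mat n n"
  shows "invertible_mat (A * B)"
proof -
  obtain A' where A': "A' \<in> carrier_mat n n" "A * A' = 1\<^sub>m n" "A' * A = 1\<^sub>m n"
    using invertible_mat_obtain[OF assms(1) A] .
  obtain B' where B': "B' \<in> carrier_mat n n" "B * B' = 1\<^sub>m n" "B' * B = 1\<^sub>m n"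
    using invertible_mat_obtain[OF assms(2) B] .
  have "A * B * (B' * A') = A * (B * B') * A'"
    using A B A'(1) B'(1) by (simp add: assoc_mult_mat[of _ n n _ n _ n])
  moreover have "B' * A' * (A * B) = B' * (A' * A) * B"
    using A B A'(1) B'(1) by (simp add: assoc_mult_mat[of _ n n _ n _ n])
  ultimately show ?thesis
    using A B A' B' by (intro invertible_mat_of_inverse[of _ n "B' * A'"]) auto
qed

text \<open>The factors \<open>transpose_mat P\<close> and \<open>P\<close> are absorbed into the
  two transforming matrices; the remaining conditions concern \<open>D\<close> alone.\<close>

lemma smith_normal_form_of_congruent:
  assumes P: "P \<in> carrier_mat n n" "invertible_mat P" and A: "A \<in> carrier_mat n n"
    and D: "smith_normal_form_of D (transpose_mat P * A * P)"
  shows "smith_normal_form_of D A"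
proof -
  obtain P' where P': "P' \<in> carrier_mat n n" "P * P' = 1\<^sub>m n" "P' * P = 1\<^sub>m n"
    using invertible_mat_obtain[OF P(2,1)] .
  have T: "invertible_mat (transpose_mat P)"
    by (rule invertible_mat_of_inverse[of _ n "transpose_mat P'"])
      (use P P' in \<open>auto simp flip: transpose_mult\<close>)
  obtain R S where R: "R \<in> carrier_mat n n" "invertible_mat R"
    and S: "S \<in> carrier_mat n n" "invertible_mat S"
    and eq: "D = R * (transpose_mat P * A * P) * S"
    using D P(1) A unfolding smith_normal_form_of_def by auto
  have "D = (R * transpose_mat P) * A * (P * S)"
    unfolding eq using P(1) A R(1) S(1) by (simp add: assoc_mult_mat[of _ n n _ n _ n])
  moreover have "invertible_mat (R * transpose_mat P)" "invertible_mat (P * S)"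
    using P(1) R S T P(2) by (auto intro!: invertible_mat_mult[of _ _ n])
  moreover have "R * transpose_mat P \<in> carrier_mat n n" "P * S \<in> carrier_mat n n"
    using P(1) R(1) S(1) by auto
  ultimately have "\<exists>R S. R \<in> carrier_mat (dim_row A) (dim_row A) \<and> invertible_mat R \<and>
      S \<in> carrier_mat (dim_col A) (dim_col A) \<and> invertible_mat S \<and> D = R * A * S"
    unfolding carrier_matD[OF A] by blast
  then show ?thesis
    using D unfolding smith_normal_form_of_def by blast
qed

text \<open>Only one side of the inverse is stated. The other comes from the same property with the
  graphs and maps exchanged, so the notion is applied in pairs.\<close>

definition potential_isometry ::
    "('v, 'e) multigraph \<Rightarrow> ('w, 'h) multigraph \<Rightarrow>
     (('v \<Rightarrow> int) \<Rightarrow> 'w \<Rightarrow> int) \<Rightarrow> (('w \<Rightarrow> int) \<Rightarrow> 'v \<Rightarrow> int) \<Rightarrow> bool" where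
  "potential_isometry X Y M M' \<longleftrightarrow>
     potential_map (verts X) (verts Y) M \<and>
     (\<forall>x. \<forall>v\<in>verts X. M' (M x) v = x v) \<and>
     (\<forall>x y. dirichlet_form Y (M x) (M y) = dirichlet_form X x y)"

lemma smith_normal_form_of_laplacian_isometry:
  assumes X: "finite_multigraph X" and Y: "finite_multigraph Y"
    and card: "card (verts X) = card (verts Y)"
    and M: "potential_isometry X Y M M'" and M': "potential_isometry Y X M' M"
    and vs: "distinct vs" "set vs = verts X" and D: "smith_normal_form_of D (laplacian X vs)"
  shows "\<exists>ws. distinct ws \<and> set ws = verts Y \<and> smith_normal_form_of D (laplacian Y ws)"
proof -
  obtain ws where ws: "set ws = verts Y" "distinct ws"
    using Y finite_distinct_list[of "verts Y"] unfolding finite_multigraph_def by metis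
  \<comment> \<open>Equal numbers of vertices make the matrix of \<open>M\<close> square, as
    \<open>invertible_mat\<close> demands.\<close>
  have len: "length ws = length vs"
    using card vs ws distinct_card by metis
  let ?P = "potential_matrix M vs ws" and ?P' = "potential_matrix M' ws vs"
  have car: "?P \<in> carrier_mat (length vs) (length vs)" "?P' \<in> carrier_mat (length vs) (length vs)"
    using len by (simp_all add: potential_matrix_def)
  have "?P' * ?P = 1\<^sub>m (length vs)"
    by (rule potential_matrix_inverse[where V = "verts X" and W = "verts Y"])
      (use M M' vs ws in \<open>auto simp: potential_isometry_def\<close>)
  moreover have "?P * ?P' = 1\<^sub>m (length ws)"
    by (rule potential_matrix_inverse[where V = "verts Y" and W = "verts X"])
      (use M M' vs ws in \<open>auto simp: potential_isometry_def\<close>)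
  ultimately have inv: "invertible_mat ?P"
    using car len by (intro invertible_mat_of_inverse[of _ _ ?P']) auto
  have eq: "laplacian X vs = transpose_mat ?P * laplacian Y ws * ?P"
    by (rule laplacian_congruence[OF X Y vs ws(2,1)]) (use M in \<open>simp add: potential_isometry_def\<close>)
  have "laplacian Y ws \<in> carrier_mat (length vs) (length vs)"
    using len by (simp add: laplacian_def)
  then have "smith_normal_form_of D (laplacian Y ws)"
    using smith_normal_form_of_congruent[OF car(1) inv] D unfolding eq by blast
  then show ?thesis using ws by blast
qed

text \<open>The groups are equal, not merely isomorphic: both arise from the same choice among the same set
  of Smith normal forms.\<close>

lemma sandpile_group_isometry:
  assumes "finite_multigraph X" "finite_multigraph Y" "card (verts X) = card (verts Y)"
    and "potential_isometry X Y M M'" "potential_isometry Y X M' M"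
  shows "sandpile_group X = sandpile_group Y"
proof -
  have "(\<exists>vs. distinct vs \<and> set vs = verts X \<and> smith_normal_form_of D (laplacian X vs)) \<longleftrightarrow>
      (\<exists>ws. distinct ws \<and> set ws = verts Y \<and> smith_normal_form_of D (laplacian Y ws))" for D
    using smith_normal_form_of_laplacian_isometry[OF assms]
      smith_normal_form_of_laplacian_isometry[OF assms(2,1) assms(3)[symmetric] assms(5,4)]
    by blast
  then have "laplacian_snf X = laplacian_snf Y"
    by (simp add: laplacian_snf_def)
  then show ?thesis by (simp add: sandpile_group_def)
qed

section \<open>Twisting potentials on a cycle with two attached graphs\<close>

text \<open>The values on \<open>v l, \<dots>, v (h + 1)\<close> are negated, read backwards and shifted so that the two end
  values stay the same: the differences along the edges \<open>l, \<dots>, h\<close> then appear in reversed order.\<close>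

definition twist :: "(nat \<Rightarrow> 'v) \<Rightarrow> nat \<Rightarrow> nat \<Rightarrow> ('v \<Rightarrow> int) \<Rightarrow> nat \<Rightarrow> int" where
  "twist v l h x k =
     (if l < k \<and> k \<le> h then x (v l) + x (v (Suc h)) - x (v (Suc (l + h) - k)) else x (v k))"

text \<open>The reflection formula reproduces the old values at both ends, so it extends from the
  open range in the definition to the closed one.\<close>

lemma twist_reflect:
  assumes "l \<le> k" "k \<le> Suc h"
  shows "twist v l h x k = x (v l) + x (v (Suc h)) - x (v (Suc (l + h) - k))"
proof -
  consider "k = l" | "k = Suc h" | "l < k" "k \<le> h" using assms by linarith
  then show ?thesis by cases (auto simp: twist_def)
qed

lemma twist_outside: "\<not> (l < k \<and> k \<le> h) \<Longrightarrow> twist v l h x k = x (v k)"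
  by (auto simp: twist_def)

text \<open>The end values, which determine the shift, survive a reflection, so the second
  reflection undoes the first. A potential \<open>y\<close> carries the intermediate values because
  \<open>twist\<close> reads potentials but returns values by index.\<close>

lemma twist_twist:
  assumes "\<And>k. k \<le> n \<Longrightarrow> y (v k) = twist v l h x k" "h < n" "k \<le> n"
  shows "twist v l h y k = x (v k)"
proof (cases "l < k \<and> k \<le> h")
  case True
  then have "y (v l) = x (v l)" "y (v (Suc h)) = x (v (Suc h))"
    using assms by (simp_all add: twist_outside)
  moreover have "y (v (Suc (l + h) - k)) = x (v l) + x (v (Suc h)) - x (v k)"
  proof -
    have "l \<le> Suc (l + h) - k" "Suc (l + h) - k \<le> Suc h" "Suc (l + h) - k \<le> n"
      using True assms(2) by auto
    then show ?thesis
      using assms(1)[of "Suc (l + h) - k"] twist_reflect[of l "Suc (l + h) - k" h v x] True by simp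
  qed
  ultimately show ?thesis
    using True by (simp add: twist_reflect)
next
  case False
  then show ?thesis using assms by (simp add: twist_outside)
qed

text \<open>Negating the values and reading them backwards each change the sign of a difference;
  together they merely move it to the mirror edge.\<close>

lemma twist_step:
  assumes "l \<le> k" "k \<le> h"
  shows "twist v l h x k - twist v l h x (Suc k) = x (v (l + h - k)) - x (v (Suc (l + h - k)))"
  using assms by (simp add: twist_reflect Suc_diff_le)

text \<open>The combinatorial content of a merging, freed from the plane. The ends of the merged
  edges are matched as unordered pairs, leaving the direction of attachment open. The merged edges 0
  and \<open>i\<close> are counted in the copies of \<open>G\<close> and \<open>F\<close>, hence
  missing from the last sum of \<open>form_J\<close>.\<close>

locale cycle_gluing =
  fixes F :: "('f, 'fe) multigraph" and a b :: 'f
    and G :: "('g, 'ge) multigraph" and c d :: 'g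
    and n :: nat and v :: "nat \<Rightarrow> 'v" and i :: nat
    and J :: "('v, 'e) multigraph" and \<gamma> :: "'g \<Rightarrow> 'v" and \<psi> :: "'f \<Rightarrow> 'v"
  assumes finite_F: "finite_multigraph F" and finite_G: "finite_multigraph G"
    and finite_J: "finite_multigraph J"
    and ab: "a \<in> verts F" "b \<in> verts F" and cd: "c \<in> verts G" "d \<in> verts G"
    and i: "1 \<le> i" "i < n"
    and inj_v: "inj_on v {..<n}" and closed: "v n = v 0"
    and inj_\<gamma>: "inj_on \<gamma> (verts G)" and inj_\<psi>: "inj_on \<psi> (verts F)"
    and verts_J: "verts J = v ` {..<n} \<union> \<gamma> ` verts G \<union> \<psi> ` verts F"
    and \<gamma>_ends: "{\<gamma> c, \<gamma> d} = {v 0, v 1}" and \<psi>_ends: "{\<psi> a, \<psi> b} = {v i, v (Suc i)}"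
    and \<gamma>_cycle: "\<gamma> ` verts G \<inter> v ` {..<n} \<subseteq> {v 0, v 1}"
    and \<psi>_cycle: "\<psi> ` verts F \<inter> v ` {..<n} \<subseteq> {v i, v (Suc i)}"
    and \<gamma>_\<psi>: "\<gamma> ` verts G \<inter> \<psi> ` verts F \<subseteq> v ` {..<n}"
    and form_J: "dirichlet_form J x y =
      dirichlet_form G (x \<circ> \<gamma>) (y \<circ> \<gamma>) + dirichlet_form F (x \<circ> \<psi>) (y \<circ> \<psi>) +
      (\<Sum>k\<in>{1..<n} - {i}. edge_form x y {v k, v (Suc k)})"
begin

lemma step_distinct:
  assumes "k < n"
  shows "v k \<noteq> v (Suc k)"
proof (cases "Suc k = n")
  \<comment> \<open>The last edge leads back to \<open>v 0\<close>; since \<open>n\<close> is at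
    least 2, its two ends have different indices.\<close>
  case True
  then show ?thesis using inj_v closed i assms by (auto simp: inj_on_def)
next
  case False
  then show ?thesis using inj_onD[OF inj_v, of k "Suc k"] assms by auto
qed

lemma cycle_vertex: "k \<le> n \<Longrightarrow> v k \<in> v ` {..<n}"
  using closed i by (cases "k = n") auto

lemma ends_in_cycle: "\<gamma> c \<in> v ` {..<n}" "\<gamma> d \<in> v ` {..<n}" "\<psi> a \<in> v ` {..<n}" "\<psi> b \<in> v ` {..<n}"
proof -
  have "{v 0, v 1} \<subseteq> v ` {..<n}" "{v i, v (Suc i)} \<subseteq> v ` {..<n}"
    using cycle_vertex[of 0] cycle_vertex[of 1] cycle_vertex[of i] cycle_vertex[of "Suc i"] i by auto
  then show "\<gamma> c \<in> v ` {..<n}" "\<gamma> d \<in> v ` {..<n}" "\<psi> a \<in> v ` {..<n}" "\<psi> b \<in> v ` {..<n}"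
    unfolding \<gamma>_ends[symmetric] \<psi>_ends[symmetric] by auto
qed

lemma verts_J_cases:
  assumes "w \<in> verts J"
  obtains (cycle) k where "k < n" "w = v k"
    | (G) u where "u \<in> verts G" "w = \<gamma> u" "\<gamma> u \<notin> v ` {..<n}"
    | (F) u where "u \<in> verts F" "w = \<psi> u" "\<psi> u \<notin> v ` {..<n}"
  using assms verts_J by blast

text \<open>Each copy shares exactly two vertices with the cycle, and the copies meet only on the
  cycle. The count is independent of \<open>i\<close>, as needed for square matrices.\<close>

lemma card_verts_J: "card (verts J) = n + (card (verts G) - 2) + (card (verts F) - 2)"
proof -
  have fin: "finite (verts G)" "finite (verts F)"
    using finite_F finite_G by (auto simp: finite_multigraph_def)
  have ne: "\<gamma> c \<noteq> \<gamma> d" "\<psi> a \<noteq> \<psi> b"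
    using \<gamma>_ends \<psi>_ends step_distinct[of 0] step_distinct[of i] i by (auto simp: doubleton_eq_iff)
  have G: "\<gamma> ` verts G \<inter> v ` {..<n} = {\<gamma> c, \<gamma> d}"
    using \<gamma>_cycle cd ends_in_cycle unfolding \<gamma>_ends[symmetric] by blast
  have F: "\<psi> ` verts F \<inter> v ` {..<n} = {\<psi> a, \<psi> b}"
    using \<psi>_cycle ab ends_in_cycle unfolding \<psi>_ends[symmetric] by blast
  have "verts J = v ` {..<n} \<union> (\<gamma> ` verts G - {\<gamma> c, \<gamma> d}) \<union> (\<psi> ` verts F - {\<psi> a, \<psi> b})"
    using verts_J F G by blast
  also have "card \<dots> = card (v ` {..<n}) + card (\<gamma> ` verts G - {\<gamma> c, \<gamma> d}) + card (\<psi> ` verts F - {\<psi> a, \<psi> b})"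
  proof -
    have "v ` {..<n} \<inter> (\<gamma> ` verts G - {\<gamma> c, \<gamma> d}) = {}" using G by blast
    moreover have "(v ` {..<n} \<union> (\<gamma> ` verts G - {\<gamma> c, \<gamma> d})) \<inter> (\<psi> ` verts F - {\<psi> a, \<psi> b}) = {}"
      using F \<gamma>_\<psi> by blast
    ultimately show ?thesis using fin by (simp add: card_Un_disjoint)
  qed
  also have "card (v ` {..<n}) = n" using card_image[OF inj_v] by simp
  also have "card (\<gamma> ` verts G - {\<gamma> c, \<gamma> d}) = card (verts G) - 2"
    using cd ne fin card_image[OF inj_\<gamma>] by (subst card_Diff_subset) auto
  also have "card (\<psi> ` verts F - {\<psi> a, \<psi> b}) = card (verts F) - 2"
    using ab ne fin card_image[OF inj_\<psi>] by (subst card_Diff_subset) auto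
  finally show ?thesis .
qed

end

section \<open>Transfer of potentials between two gluings\<close>

text \<open>Everything is symmetric in the two gluings, so that the inverse of the transfer map is the
  transfer map of the swapped locale.\<close>

locale two_cycle_gluings =
  J: cycle_gluing F a b G c d n v i J \<gamma> \<psi> + J': cycle_gluing F a b G c d n v j J' \<gamma>' \<psi>'
  for F :: "('f, 'fe) multigraph" and a b :: 'f
    and G :: "('g, 'ge) multigraph" and c d :: 'g
    and n :: nat and v :: "nat \<Rightarrow> 'v" and i j :: nat
    and J J' :: "('v, 'e) multigraph" and \<gamma> \<gamma>' :: "'g \<Rightarrow> 'v" and \<psi> \<psi>' :: "'f \<Rightarrow> 'v"
begin

text \<open>Reflecting this range exchanges the cycle edges \<open>i\<close> and \<open>j\<close>.
  Edge 0, where \<open>G\<close> is attached, stays fixed because both indices are at least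
  1.\<close>

abbreviation "tw \<equiv> twist v (min i j) (max i j)"

lemma tw_n: "tw x n = tw x 0"
  using J.i J'.i J.closed by (auto simp: twist_def)

definition on_cycle :: "('v \<Rightarrow> int) \<Rightarrow> 'v \<Rightarrow> int" where
  "on_cycle x w = tw x (the_inv_into {..<n} v w)"

lemma on_cycle_v: "k \<le> n \<Longrightarrow> on_cycle x (v k) = tw x k"
  using J.i J.closed tw_n by (cases "k = n") (auto simp: on_cycle_def the_inv_into_f_f[OF J.inj_v])

text \<open>The signs record whether a copy is attached in the opposite direction along the cycle.\<close>

definition sign_G :: int where "sign_G = (if \<gamma>' c = \<gamma> c then 1 else -1)"
definition sign_F :: int where "sign_F = (if (\<psi> a = v i) = (\<psi>' a = v j) then 1 else -1)"

lemma sign_sq: "sign_G * sign_G = 1" "sign_F * sign_F = 1"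
  by (simp_all add: sign_G_def sign_F_def)

text \<open>The difference along edge 0 is kept, up to the direction of attachment recorded by
  \<open>sign_G\<close>. So the value extrapolated from \<open>c\<close> agrees at \<open>d\<close>
  with the one on the cycle.\<close>

lemma on_cycle_ends_G: "on_cycle x (\<gamma>' d) = on_cycle x (\<gamma>' c) + sign_G * (x (\<gamma> d) - x (\<gamma> c))"
proof -
  have "on_cycle x (v 0) = x (v 0)" "on_cycle x (v 1) = x (v 1)"
    using on_cycle_v[of 0 x] on_cycle_v[of 1 x] J.i J'.i by (auto simp: twist_outside)
  moreover have "\<gamma> c = v 0 \<and> \<gamma> d = v 1 \<or> \<gamma> c = v 1 \<and> \<gamma> d = v 0"
    "\<gamma>' c = v 0 \<and> \<gamma>' d = v 1 \<or> \<gamma>' c = v 1 \<and> \<gamma>' d = v 0"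
    using J.\<gamma>_ends J'.\<gamma>_ends by (auto simp: doubleton_eq_iff)
  ultimately show ?thesis
    using J.step_distinct[of 0] J.i by (auto simp: sign_G_def)
qed

text \<open>The reflection carries the difference along edge \<open>i\<close> to edge
  \<open>j\<close>, that is, from one merged edge of \<open>F\<close> to the other;
  \<open>sign_F\<close> accounts for the directions.\<close>

lemma on_cycle_ends_F: "on_cycle x (\<psi>' b) = on_cycle x (\<psi>' a) + sign_F * (x (\<psi> b) - x (\<psi> a))"
proof -
  have "tw x j - tw x (Suc j) = x (v i) - x (v (Suc i))"
    using twist_step[of "min i j" j "max i j" v x] by (simp add: min_def max_def split: if_splits)
  then have "on_cycle x (v j) - on_cycle x (v (Suc j)) = x (v i) - x (v (Suc i))"
    using J'.i by (simp add: on_cycle_v)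
  moreover have "\<psi> a = v i \<and> \<psi> b = v (Suc i) \<or> \<psi> a = v (Suc i) \<and> \<psi> b = v i"
    "\<psi>' a = v j \<and> \<psi>' b = v (Suc j) \<or> \<psi>' a = v (Suc j) \<and> \<psi>' b = v j"
    using J.\<psi>_ends J'.\<psi>_ends by (auto simp: doubleton_eq_iff)
  ultimately show ?thesis
    using J.step_distinct[of i] J.step_distinct[of j] J.i J'.i by (auto simp: sign_F_def)
qed

text \<open>The constant on each copy is chosen to match the cycle at \<open>c\<close> or
  \<open>a\<close>. The cases overlap only at ends of merged edges, where \<open>transfer_G\<close>
  and \<open>transfer_F\<close> show that they are consistent.\<close>

definition transfer :: "('v \<Rightarrow> int) \<Rightarrow> 'v \<Rightarrow> int" where
  "transfer x w =
     (if w \<in> v ` {..<n} then on_cycle x w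
      else if w \<in> \<gamma>' ` verts G
        then on_cycle x (\<gamma>' c) + sign_G * (x (\<gamma> (the_inv_into (verts G) \<gamma>' w)) - x (\<gamma> c))
      else on_cycle x (\<psi>' a) + sign_F * (x (\<psi> (the_inv_into (verts F) \<psi>' w)) - x (\<psi> a)))"

lemma transfer_v: "k \<le> n \<Longrightarrow> transfer x (v k) = tw x k"
  using J.cycle_vertex by (simp add: transfer_def on_cycle_v)

lemma transfer_G:
  assumes "u \<in> verts G"
  shows "transfer x (\<gamma>' u) = on_cycle x (\<gamma>' c) + sign_G * (x (\<gamma> u) - x (\<gamma> c))"
proof (cases "\<gamma>' u \<in> v ` {..<n}")
  case True
  \<comment> \<open>Only \<open>c\<close> and \<open>d\<close> can land on the cycle: at
    \<open>c\<close> the formula is trivial, at \<open>d\<close> it is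
    \<open>on_cycle_ends_G\<close>.\<close>
  then have "\<gamma>' u \<in> {\<gamma>' c, \<gamma>' d}" using assms J'.\<gamma>_cycle J'.\<gamma>_ends by blast
  then have "u = c \<or> u = d" using J'.inj_\<gamma> J'.cd assms by (auto simp: inj_on_def)
  then show ?thesis
    using True on_cycle_ends_G[of x] by (auto simp: transfer_def)
next
  case False
  then show ?thesis using assms by (simp add: transfer_def the_inv_into_f_f[OF J'.inj_\<gamma>])
qed

lemma transfer_F:
  assumes "u \<in> verts F"
  shows "transfer x (\<psi>' u) = on_cycle x (\<psi>' a) + sign_F * (x (\<psi> u) - x (\<psi> a))"
proof (cases "\<psi>' u \<in> v ` {..<n}")
  case True
  then have "\<psi>' u \<in> {\<psi>' a, \<psi>' b}" using assms J'.\<psi>_cycle J'.\<psi>_ends by blast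
  then have "u = a \<or> u = b" using J'.inj_\<psi> J'.ab assms by (auto simp: inj_on_def)
  then show ?thesis
    using True on_cycle_ends_F[of x] by (auto simp: transfer_def)
next
  case False
  moreover have "\<psi>' u \<notin> \<gamma>' ` verts G" using False assms J'.\<gamma>_\<psi> by blast
  ultimately show ?thesis using assms by (simp add: transfer_def the_inv_into_f_f[OF J'.inj_\<psi>])
qed

lemma tw_add: "tw (\<lambda>w. x w + y w) k = tw x k + tw y k"
  by (simp add: twist_def)

lemma on_cycle_cong:
  assumes "\<And>w. w \<in> verts J \<Longrightarrow> x w = y w" "w \<in> v ` {..<n}"
  shows "on_cycle x w = on_cycle y w"
proof -
  obtain k where k: "k < n" "w = v k" using assms(2) by auto
  have "x (v l) = y (v l)" if "l \<le> n" for l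
    using assms(1) J.verts_J J.cycle_vertex[OF that] by blast
  then have "tw x k = tw y k"
    using k J.i J'.i by (auto simp: twist_def)
  then show ?thesis using k by (simp add: on_cycle_v)
qed

lemma potential_map_transfer: "potential_map (verts J) (verts J') transfer"
  unfolding potential_map_def
proof (intro conjI allI ballI impI)
  fix x y w assume "w \<in> verts J'"
  then show "transfer (\<lambda>w. x w + y w) w = transfer x w + transfer y w"
    by (cases rule: J'.verts_J_cases)
      (simp_all add: transfer_v transfer_G transfer_F on_cycle_def tw_add algebra_simps)
next
  fix x y :: "'v \<Rightarrow> int" and w assume eq: "\<forall>u\<in>verts J. x u = y u" and "w \<in> verts J'"
  have G: "x (\<gamma> u) = y (\<gamma> u)" if "u \<in> verts G" for u using eq that J.verts_J by blast
  have F: "x (\<psi> u) = y (\<psi> u)" if "u \<in> verts F" for u using eq that J.verts_J by blast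
  have C: "on_cycle x u = on_cycle y u" if "u \<in> v ` {..<n}" for u
    using on_cycle_cong eq that by blast
  from \<open>w \<in> verts J'\<close> show "transfer x w = transfer y w"
  proof (cases rule: J'.verts_J_cases)
    case (cycle k)
    then show ?thesis using C by (simp add: transfer_def)
  next
    case (G u)
    then show ?thesis using C J'.ends_in_cycle \<open>\<And>u. u \<in> verts G \<Longrightarrow> x (\<gamma> u) = y (\<gamma> u)\<close> J.cd
      by (simp add: transfer_G)
  next
    case (F u)
    then show ?thesis using C J'.ends_in_cycle \<open>\<And>u. u \<in> verts F \<Longrightarrow> x (\<psi> u) = y (\<psi> u)\<close> J.ab
      by (simp add: transfer_F)
  qed
qed

lemma edge_form_step:
  assumes "k < n"
  shows "edge_form x y {v k, v (Suc k)} =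
    2 * ((x (v k) - x (v (Suc k))) * (y (v k) - y (v (Suc k))))"
  by (rule edge_form_pair) (rule J.step_distinct[OF assms])

text \<open>The form splits into the two copies, where the transfer is a sign and a shift, and the
  remaining cycle edges, whose differences are permuted.\<close>

lemma transfer_form: "dirichlet_form J' (transfer x) (transfer y) = dirichlet_form J x y"
proof -
  have "dirichlet_form G (transfer x \<circ> \<gamma>') (transfer y \<circ> \<gamma>') =
      dirichlet_form G (\<lambda>u. (on_cycle x (\<gamma>' c) - sign_G * x (\<gamma> c)) + sign_G * (x \<circ> \<gamma>) u)
        (\<lambda>u. (on_cycle y (\<gamma>' c) - sign_G * y (\<gamma> c)) + sign_G * (y \<circ> \<gamma>) u)"
    by (rule dirichlet_form_cong[OF J.finite_G]) (simp_all add: transfer_G algebra_simps)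
  also have "\<dots> = dirichlet_form G (x \<circ> \<gamma>) (y \<circ> \<gamma>)"
    by (rule dirichlet_form_affine[OF sign_sq(1)])
  finally have G: "dirichlet_form G (transfer x \<circ> \<gamma>') (transfer y \<circ> \<gamma>') =
    dirichlet_form G (x \<circ> \<gamma>) (y \<circ> \<gamma>)" .
  have "dirichlet_form F (transfer x \<circ> \<psi>') (transfer y \<circ> \<psi>') =
      dirichlet_form F (\<lambda>u. (on_cycle x (\<psi>' a) - sign_F * x (\<psi> a)) + sign_F * (x \<circ> \<psi>) u)
        (\<lambda>u. (on_cycle y (\<psi>' a) - sign_F * y (\<psi> a)) + sign_F * (y \<circ> \<psi>) u)"
    by (rule dirichlet_form_cong[OF J.finite_F]) (simp_all add: transfer_F algebra_simps)
  also have "\<dots> = dirichlet_form F (x \<circ> \<psi>) (y \<circ> \<psi>)"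
    by (rule dirichlet_form_affine[OF sign_sq(2)])
  finally have F: "dirichlet_form F (transfer x \<circ> \<psi>') (transfer y \<circ> \<psi>') =
    dirichlet_form F (x \<circ> \<psi>) (y \<circ> \<psi>)" .
  \<comment> \<open>The permutation of edge indices induced by the reflection. It is an involution
    exchanging \<open>i\<close> and \<open>j\<close>, hence matches the unmerged edges of the two
    cycles.\<close>
  define r where "r k = (if min i j \<le> k \<and> k \<le> max i j then i + j - k else k)" for k
  have r_r: "r (r k) = k" for k
    by (auto simp: r_def min_def max_def)
  have r_mem: "r k \<in> {1..<n} - {i}" if "k \<in> {1..<n} - {j}" for k
    using that J.i J'.i by (auto simp: r_def min_def max_def)
  have r_mem': "r k \<in> {1..<n} - {j}" if "k \<in> {1..<n} - {i}" for k
    using that J.i J'.i by (auto simp: r_def min_def max_def)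
  have step: "transfer z (v k) - transfer z (v (Suc k)) = z (v (r k)) - z (v (Suc (r k)))"
    if "k < n" for k z
  proof -
    have "tw z k - tw z (Suc k) = z (v (r k)) - z (v (Suc (r k)))"
    proof (cases "min i j \<le> k \<and> k \<le> max i j")
      case True
      then show ?thesis using twist_step[of "min i j" k "max i j" v z]
        by (simp add: r_def min_def max_def add.commute split: if_splits)
    next
      case False
      then show ?thesis by (auto simp: r_def twist_outside)
    qed
    then show ?thesis using that by (simp add: transfer_v)
  qed
  have "(\<Sum>k\<in>{1..<n} - {j}. edge_form (transfer x) (transfer y) {v k, v (Suc k)}) =
      (\<Sum>k\<in>{1..<n} - {i}. edge_form x y {v k, v (Suc k)})"
  proof (rule sum.reindex_bij_witness[of _ r r])
    fix k assume k: "k \<in> {1..<n} - {j}"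
    then have "k < n" "r k < n" using r_mem[OF k] by auto
    then show "edge_form x y {v (r k), v (Suc (r k))} =
        edge_form (transfer x) (transfer y) {v k, v (Suc k)}"
      by (simp only: edge_form_step step)
  qed (use r_r r_mem r_mem' in auto)
  then show ?thesis
    unfolding J.form_J J'.form_J F G by simp
qed

end

text \<open>Exchanging \<open>i\<close> and \<open>j\<close> keeps the reflected range and both
  signs. Hence the cycle is reflected twice, and differences on the copies receive each sign
  twice.\<close>

lemma (in two_cycle_gluings) transfer_inverse:
  assumes "w \<in> verts J"
  shows "two_cycle_gluings.transfer F a G c n v j i \<gamma>' \<gamma> \<psi>' \<psi> (transfer x) w = x w"
proof -
  interpret R: two_cycle_gluings F a b G c d n v j i J' J \<gamma>' \<gamma> \<psi>' \<psi>
    by unfold_locales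
  have tw: "R.tw (transfer x) k = x (v k)" if "k \<le> n" for k
    using twist_twist[of n "transfer x" v "min i j" "max i j" x k] transfer_v that J.i J'.i
    by (simp add: min.commute max.commute)
  have cyc: "R.on_cycle (transfer x) w = x w" if "w \<in> v ` {..<n}" for w
    using that tw by (auto simp: R.on_cycle_v)
  have sG: "R.sign_G = sign_G" by (auto simp: R.sign_G_def sign_G_def)
  have sF: "R.sign_F = sign_F" by (auto simp: R.sign_F_def sign_F_def)
  from assms show ?thesis
  proof (cases rule: J.verts_J_cases)
    case (cycle k)
    then show ?thesis using tw by (simp add: R.transfer_v)
  next
    case (G u)
    have "sign_G * (transfer x (\<gamma>' u) - transfer x (\<gamma>' c)) = sign_G * sign_G * (x (\<gamma> u) - x (\<gamma> c))"
      using G(1) J.cd by (simp add: transfer_G algebra_simps)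
    then show ?thesis
      using G cyc J.ends_in_cycle sign_sq by (simp add: R.transfer_G sG)
  next
    case (F u)
    have "sign_F * (transfer x (\<psi>' u) - transfer x (\<psi>' a)) = sign_F * sign_F * (x (\<psi> u) - x (\<psi> a))"
      using F(1) J.ab by (simp add: transfer_F algebra_simps)
    then show ?thesis
      using F cyc J.ends_in_cycle sign_sq by (simp add: R.transfer_F sF)
  qed
qed

lemma (in two_cycle_gluings) sandpile_group_eq: "sandpile_group J = sandpile_group J'"
proof -
  interpret R: two_cycle_gluings F a b G c d n v j i J' J \<gamma>' \<gamma> \<psi>' \<psi>
    by unfold_locales
  have "potential_isometry J J' transfer R.transfer"
    using potential_map_transfer transfer_form transfer_inverse by (simp add: potential_isometry_def)
  moreover have "potential_isometry J' J R.transfer transfer"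
    using R.potential_map_transfer R.transfer_form R.transfer_inverse by (simp add: potential_isometry_def)
  moreover have "card (verts J) = card (verts J')"
    by (simp add: J.card_verts_J J'.card_verts_J)
  ultimately show ?thesis
    using sandpile_group_isometry J.finite_J J'.finite_J by blast
qed

section \<open>Plane graphs merged with a cycle\<close>

lemma plane_edge_card_ends:
  assumes "plane_multigraph X" "e \<in> pedges X"
  shows "card (e \<inter> pverts X) = 2"
  using finite_multigraph_underlying_graph[OF assms(1)] assms(2)
  by (simp add: finite_multigraph_def underlying_graph_def)

lemma plane_edge_infinite:
  assumes "plane_multigraph X" "e \<in> pedges X"
  shows "infinite e"
proof -
  obtain p where "arc p" "path_image p = e"
    using assms unfolding plane_multigraph_def by meson
  then show ?thesis
    using arc_image_uncountable countable_finite by blast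
qed

text \<open>Distinct edges meet in finitely many vertices, whereas an arc is infinite.\<close>

lemma plane_edge_eqI:
  assumes X: "plane_multigraph X" and "e \<in> pedges X" "e' \<in> pedges X" "e \<subseteq> e'"
  shows "e = e'"
proof (rule ccontr)
  assume "e \<noteq> e'"
  then have "e \<subseteq> pverts X" using assms unfolding plane_multigraph_def by blast
  moreover have "finite (pverts X)" using X by (simp add: plane_multigraph_def)
  ultimately show False
    using plane_edge_infinite[OF X assms(2)] finite_subset by blast
qed

lemma plane_isotopic_to_id_inj:
  assumes "plane_isotopic_to_id \<phi>"
  shows "inj \<phi>"
proof -
  obtain \<phi>' where "homeomorphism UNIV UNIV \<phi> \<phi>'"
    using homotopic_with_imp_property assms unfolding plane_isotopic_to_id_def by blast
  then show ?thesis by (metis UNIV_I homeomorphism_apply1 injI)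
qed

text \<open>No foreign vertex of \<open>J\<close> lies on a moved edge: as an edge of
  \<open>J\<close> it carries exactly two vertices, and the images of its own ends are already
  two.\<close>

lemma plane_edge_ends_move:
  assumes X: "plane_multigraph X" and J: "plane_multigraph J" and \<phi>: "inj \<phi>"
    and sub: "pverts (move \<phi> X) \<subseteq> pverts J" "pedges (move \<phi> X) \<subseteq> pedges J"
    and e: "e \<in> pedges X"
  shows "\<phi> ` e \<inter> pverts J = \<phi> ` (e \<inter> pverts X)"
proof (rule sym, rule card_subset_eq)
  show "finite (\<phi> ` e \<inter> pverts J)" using J by (simp add: plane_multigraph_def)
  show "\<phi> ` (e \<inter> pverts X) \<subseteq> \<phi> ` e \<inter> pverts J" using sub(1) by (auto simp: move_def)
  have "card (\<phi> ` (e \<inter> pverts X)) = 2"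
    using plane_edge_card_ends[OF X e] \<phi> by (simp add: card_image inj_on_subset)
  moreover have "card (\<phi> ` e \<inter> pverts J) = 2"
    using e sub(2) by (intro plane_edge_card_ends[OF J]) (auto simp: move_def)
  ultimately show "card (\<phi> ` (e \<inter> pverts X)) = card (\<phi> ` e \<inter> pverts J)" by simp
qed

lemma dirichlet_form_move:
  assumes X: "plane_multigraph X" and J: "plane_multigraph J" and \<phi>: "inj \<phi>"
    and sub: "pverts (move \<phi> X) \<subseteq> pverts J" "pedges (move \<phi> X) \<subseteq> pedges J"
  shows "(\<Sum>e\<in>pedges (move \<phi> X). edge_form x y (e \<inter> pverts J)) =
    dirichlet_form (underlying_graph X) (x \<circ> \<phi>) (y \<circ> \<phi>)"
proof -
  have "inj_on ((`) \<phi>) (pedges X)"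
    using \<phi> by (simp add: inj_on_def inj_image_eq_iff)
  then have "(\<Sum>e\<in>pedges (move \<phi> X). edge_form x y (e \<inter> pverts J)) =
      (\<Sum>e\<in>pedges X. edge_form x y (\<phi> ` e \<inter> pverts J))"
    by (simp add: move_def sum.reindex)
  also have "\<dots> = (\<Sum>e\<in>pedges X. edge_form (x \<circ> \<phi>) (y \<circ> \<phi>) (e \<inter> pverts X))"
  proof (rule sum.cong[OF refl])
    fix e assume "e \<in> pedges X"
    then show "edge_form x y (\<phi> ` e \<inter> pverts J) = edge_form (x \<circ> \<phi>) (y \<circ> \<phi>) (e \<inter> pverts X)"
      using plane_edge_ends_move[OF assms] \<phi> by (simp add: edge_form_image inj_on_subset)
  qed
  finally show ?thesis
    by (simp add: dirichlet_form_def underlying_graph_def)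
qed

text \<open>The passage from drawings to combinatorics: the prescribed intersections of the drawings
  determine which vertices and edges the cycle and the copies share.\<close>

lemma cycle_merging_imp_cycle_gluing:
  assumes F: "plane_multigraph F" "f \<in> pedges F" "f \<inter> pverts F = {a, b}"
    and G: "plane_multigraph G" "g \<in> pedges G" "g \<inter> pverts G = {c, d}"
    and v: "inj_on v {..<n}" "v n = v 0" and t: "inj_on t {..<n}"
    and T: "plane_multigraph T" "pverts T = v ` {..<n}" "pedges T = t ` {..<n}"
    and tk: "\<And>k. k < n \<Longrightarrow> t k \<inter> pverts T = {v k, v (Suc k)}"
    and i: "1 \<le> i" "i < n" and J: "cycle_merging F f G g n t T i J"
  shows "\<exists>\<gamma> \<psi>. cycle_gluing (underlying_graph F) a b (underlying_graph G) c d n v i (underlying_graph J) \<gamma> \<psi>"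
proof -
  obtain G' F' where G': "merged_copy G g T (t 0) G'" and F': "merged_copy F f T (t i) F'"
    and GF: "drawing G' \<inter> drawing F' = t 0 \<inter> t i"
    and J_eq: "J = plane_union T (plane_union G' F')" and pJ: "plane_multigraph J"
    using J unfolding cycle_merging_def by blast
  obtain \<gamma> where \<gamma>: "inj \<gamma>" "G' = move \<gamma> G" "\<gamma> ` g = t 0"
    and GT: "drawing G' \<inter> drawing T = t 0"
    using G' plane_isotopic_to_id_inj unfolding merged_copy_def by blast
  obtain \<psi> where \<psi>: "inj \<psi>" "F' = move \<psi> F" "\<psi> ` f = t i"
    and FT: "drawing F' \<inter> drawing T = t i"
    using F' plane_isotopic_to_id_inj unfolding merged_copy_def by blast
  have vJ: "pverts J = v ` {..<n} \<union> \<gamma> ` pverts G \<union> \<psi> ` pverts F"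
    by (auto simp: J_eq plane_union_def \<gamma>(2) \<psi>(2) move_def T(2))
  have eJ: "pedges J = t ` {..<n} \<union> pedges G' \<union> pedges F'"
    by (auto simp: J_eq plane_union_def T(3))
  have subG: "pverts (move \<gamma> G) \<subseteq> pverts J" "pedges (move \<gamma> G) \<subseteq> pedges J"
    and subF: "pverts (move \<psi> F) \<subseteq> pverts J" "pedges (move \<psi> F) \<subseteq> pedges J"
    using \<gamma>(2) \<psi>(2) by (auto simp: J_eq plane_union_def)
  \<comment> \<open>The copies add no vertex to a cycle edge, since it has two vertices in
    \<open>T\<close> and again just two in \<open>J\<close>.\<close>
  have tJ: "t k \<inter> pverts J = {v k, v (Suc k)}" if "k < n" for k
  proof -
    have e: "t k \<in> pedges T" "t k \<in> pedges J" using that T(3) eJ by auto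
    have "pverts T \<subseteq> pverts J" using vJ T(2) by blast
    then have "t k \<inter> pverts T = t k \<inter> pverts J"
      using plane_edge_card_ends[OF T(1) e(1)] plane_edge_card_ends[OF pJ e(2)] pJ
      by (intro card_subset_eq) (auto simp: plane_multigraph_def)
    then show ?thesis using tk[OF that] by simp
  qed
  have t_in: "0 < n" "t 0 \<in> pedges G'" "t i \<in> pedges F'"
    using i \<gamma>(2) \<psi>(2) F(2) G(2) by (auto simp: move_def simp flip: \<gamma>(3) \<psi>(3))
  have t0: "\<gamma> ` (g \<inter> pverts G) = {v 0, v 1}"
    using plane_edge_ends_move[OF G(1) pJ \<gamma>(1) subG G(2)] \<gamma>(3) tJ[of 0] t_in(1) by simp
  have ti: "\<psi> ` (f \<inter> pverts F) = {v i, v (Suc i)}"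
    using plane_edge_ends_move[OF F(1) pJ \<psi>(1) subF F(2)] \<psi>(3) tJ[of i] i by simp
  have draw: "v ` {..<n} \<subseteq> drawing T" "\<gamma> ` pverts G \<subseteq> drawing G'" "\<psi> ` pverts F \<subseteq> drawing F'"
    by (auto simp: drawing_def T(2) \<gamma>(2) \<psi>(2) move_def)
  have edraw: "e \<in> pedges X \<Longrightarrow> e \<subseteq> drawing X" for e X
    by (auto simp: drawing_def)
  \<comment> \<open>A cycle edge that also belongs to the copy lies in both drawings, so inside
    \<open>t 0\<close>, and nested edges coincide.\<close>
  have tG: "t k \<in> pedges G' \<longleftrightarrow> k = 0" if "k < n" for k
  proof
    assume "t k \<in> pedges G'"
    then have "t k \<subseteq> t 0" using edraw[of "t k" G'] edraw[of "t k" T] GT T(3) that by blast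
    then have "t k = t 0" using plane_edge_eqI[OF pJ] eJ that t_in(1) by blast
    then show "k = 0" using inj_onD[OF t] that t_in(1) by blast
  qed (use t_in in simp)
  have tF: "t k \<in> pedges F' \<longleftrightarrow> k = i" if "k < n" for k
  proof
    assume "t k \<in> pedges F'"
    then have "t k \<subseteq> t i" using edraw[of "t k" F'] edraw[of "t k" T] FT T(3) that by blast
    then have "t k = t i" using plane_edge_eqI[OF pJ] eJ that i(2) by blast
    then show "k = i" using inj_onD[OF t] that i(2) by blast
  qed (use t_in in simp)
  \<comment> \<open>A common edge would lie inside both \<open>t 0\<close> and \<open>t i\<close>
    and hence equal both.\<close>
  have disj: "pedges G' \<inter> pedges F' = {}"
  proof (rule ccontr)
    assume "pedges G' \<inter> pedges F' \<noteq> {}"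
    then obtain e where e: "e \<in> pedges G'" "e \<in> pedges F'" by blast
    then have "e \<subseteq> t 0" "e \<subseteq> t i" using edraw[of e G'] edraw[of e F'] GF by blast+
    then have "e = t 0" "e = t i" using plane_edge_eqI[OF pJ] e eJ t_in by blast+
    then show False using tG[of i] i t_in e by auto
  qed
  have edges_split: "pedges J = pedges G' \<union> pedges F' \<union> t ` ({1..<n} - {i})"
  proof -
    have "{..<n} = insert 0 (insert i ({1..<n} - {i}))" using i by auto
    then have "t ` {..<n} = {t 0, t i} \<union> t ` ({1..<n} - {i})" by (metis image_insert insert_is_Un Un_assoc)
    then show ?thesis using eJ t_in by auto
  qed
  have disj': "(pedges G' \<union> pedges F') \<inter> t ` ({1..<n} - {i}) = {}"
    using tG tF by auto
  have fin: "finite (pedges G')" "finite (pedges F')"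
    using pJ eJ by (auto simp: plane_multigraph_def)
  have form: "dirichlet_form (underlying_graph J) x y =
      dirichlet_form (underlying_graph G) (x \<circ> \<gamma>) (y \<circ> \<gamma>) +
      dirichlet_form (underlying_graph F) (x \<circ> \<psi>) (y \<circ> \<psi>) +
      (\<Sum>k\<in>{1..<n} - {i}. edge_form x y {v k, v (Suc k)})" for x y
  proof -
    have "dirichlet_form (underlying_graph J) x y = (\<Sum>e\<in>pedges J. edge_form x y (e \<inter> pverts J))"
      by (simp add: dirichlet_form_def underlying_graph_def)
    also have "\<dots> = (\<Sum>e\<in>pedges G'. edge_form x y (e \<inter> pverts J)) +
        (\<Sum>e\<in>pedges F'. edge_form x y (e \<inter> pverts J)) +
        (\<Sum>e\<in>t ` ({1..<n} - {i}). edge_form x y (e \<inter> pverts J))"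
      unfolding edges_split using disj disj' fin by (simp add: sum.union_disjoint)
    also have "(\<Sum>e\<in>t ` ({1..<n} - {i}). edge_form x y (e \<inter> pverts J)) =
        (\<Sum>k\<in>{1..<n} - {i}. edge_form x y (t k \<inter> pverts J))"
      by (rule sum.reindex_cong[OF inj_on_subset[OF t]]) auto
    also have "\<dots> = (\<Sum>k\<in>{1..<n} - {i}. edge_form x y {v k, v (Suc k)})"
      by (rule sum.cong) (simp_all add: tJ)
    finally show ?thesis
      unfolding \<gamma>(2) \<psi>(2) dirichlet_form_move[OF G(1) pJ \<gamma>(1) subG]
        dirichlet_form_move[OF F(1) pJ \<psi>(1) subF] .
  qed
  have "cycle_gluing (underlying_graph F) a b (underlying_graph G) c d n v i (underlying_graph J) \<gamma> \<psi>"
  proof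
    show "finite_multigraph (underlying_graph F)" "finite_multigraph (underlying_graph G)"
      "finite_multigraph (underlying_graph J)"
      by (intro finite_multigraph_underlying_graph F G pJ)+
    show "a \<in> verts (underlying_graph F)" "b \<in> verts (underlying_graph F)"
      "c \<in> verts (underlying_graph G)" "d \<in> verts (underlying_graph G)"
      using F(3) G(3) by (auto simp: underlying_graph_def)
    show "inj_on \<gamma> (verts (underlying_graph G))" "inj_on \<psi> (verts (underlying_graph F))"
      using \<gamma>(1) \<psi>(1) inj_on_subset by blast+
    show "verts (underlying_graph J) =
        v ` {..<n} \<union> \<gamma> ` verts (underlying_graph G) \<union> \<psi> ` verts (underlying_graph F)"
      using vJ by (simp add: underlying_graph_def)
    show "{\<gamma> c, \<gamma> d} = {v 0, v 1}" "{\<psi> a, \<psi> b} = {v i, v (Suc i)}"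
      using t0 ti F(3) G(3) by simp_all
    have "\<gamma> ` pverts G \<inter> v ` {..<n} \<subseteq> t 0 \<inter> pverts J" using draw GT vJ by blast
    then show "\<gamma> ` verts (underlying_graph G) \<inter> v ` {..<n} \<subseteq> {v 0, v 1}"
      using tJ[of 0] t_in(1) by (simp add: underlying_graph_def)
    have "\<psi> ` pverts F \<inter> v ` {..<n} \<subseteq> t i \<inter> pverts J" using draw FT vJ by blast
    then show "\<psi> ` verts (underlying_graph F) \<inter> v ` {..<n} \<subseteq> {v i, v (Suc i)}"
      using tJ[of i] i by (simp add: underlying_graph_def)
    have "\<gamma> ` pverts G \<inter> \<psi> ` pverts F \<subseteq> t 0 \<inter> pverts J" using draw GF vJ by blast
    also have "\<dots> = t 0 \<inter> pverts T" using tJ[of 0] tk[of 0] t_in(1) by simp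
    finally show "\<gamma> ` verts (underlying_graph G) \<inter> \<psi> ` verts (underlying_graph F) \<subseteq> v ` {..<n}"
      using T(2) by (auto simp: underlying_graph_def)
  qed (use i v form in \<open>simp_all add: form\<close>)
  then show ?thesis by blast
qed

theorem theorem2:
  fixes F G T J J' :: plane_graph
    and f g :: "complex set"
    and t :: "nat \<Rightarrow> complex set"
    and n i j :: nat
  assumes "plane_multigraph F" and "on_outer_face F f"
    and "plane_multigraph G" and "on_outer_face G g"
    and "plane_cycle n t T"
    and "1 \<le> i" and "i \<le> n - 1" and "cycle_merging F f G g n t T i J"
    and "1 \<le> j" and "j \<le> n - 1" and "cycle_merging F f G g n t T j J'"
  shows "sandpile_group (underlying_graph J) \<cong> sandpile_group (underlying_graph J')"
proof -
  have f: "f \<in> pedges F" and g: "g \<in> pedges G"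
    using assms(2,4) by (auto simp: on_outer_face_def)
  obtain a b where ab: "f \<inter> pverts F = {a, b}"
    using plane_edge_card_ends[OF assms(1) f] by (auto simp: card_2_iff)
  obtain c d where cd: "g \<inter> pverts G = {c, d}"
    using plane_edge_card_ends[OF assms(3) g] by (auto simp: card_2_iff)
  obtain v0 where T: "plane_multigraph T" "inj_on v0 {..<n}" "pverts T = v0 ` {..<n}"
    "inj_on t {..<n}" "pedges T = t ` {..<n}"
    "\<And>k. k < n \<Longrightarrow> t k \<inter> pverts T = {v0 k, v0 (Suc k mod n)}"
    using assms(5) unfolding plane_cycle_def by blast
  \<comment> \<open>The periodic extension of \<open>v0\<close> yields \<open>v n = v 0\<close> and
    replaces the successor modulo \<open>n\<close> by \<open>Suc\<close>.\<close>
  define v where "v k = v0 (k mod n)" for k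
  have v: "inj_on v {..<n}" "v n = v 0" "pverts T = v ` {..<n}"
    "\<And>k. k < n \<Longrightarrow> t k \<inter> pverts T = {v k, v (Suc k)}"
    using T by (auto simp: v_def inj_on_def)
  have ij: "i < n" "j < n" using assms(6,7,9,10) by auto
  note gluing =
    cycle_merging_imp_cycle_gluing[OF assms(1) f ab assms(3) g cd v(1,2) T(4,1) v(3) T(5) v(4)]
  obtain \<gamma> \<psi> where "cycle_gluing (underlying_graph F) a b (underlying_graph G) c d n v i
      (underlying_graph J) \<gamma> \<psi>"
    using gluing[OF _ assms(6) ij(1) assms(8)] by blast
  moreover obtain \<gamma>' \<psi>' where "cycle_gluing (underlying_graph F) a b (underlying_graph G) c d n v j
      (underlying_graph J') \<gamma>' \<psi>'"
    using gluing[OF _ assms(9) ij(2) assms(11)] by blast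
  ultimately have "two_cycle_gluings (underlying_graph F) a b (underlying_graph G) c d n v i j
      (underlying_graph J) (underlying_graph J') \<gamma> \<gamma>' \<psi> \<psi>'"
    by (simp add: two_cycle_gluings_def)
  then show ?thesis
    using two_cycle_gluings.sandpile_group_eq iso_refl by metis
qed

end
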